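(* Let $\rho_1\ge\rho_2>0$, $\sigma^2>0$, $r>0$ and $\phi_1,\phi_2\ge0$. Consider the strong and weak features model with $\gamma=2$, $\psi_1=\psi_2=1/2$ and $\mathbf E[\|\beta^\star\|_2^2]=r^2$, i.e. $\phi_1\psi_1+\phi_2\psi_2=1$, and let $R_{\mathrm{Asym}}(\lambda)$ be its asymptotic ridge risk (defined in the context). If $$\frac{r^2}{\sigma^2}\,\frac{\rho_1\rho_2}{(\sqrt{\rho_1}+\sqrt{\rho_2})^2}\left(\frac{\phi_1\sqrt{\rho_1}+\phi_2\sqrt{\rho_2}}{\sqrt{\rho_1}+\sqrt{\rho_2}}-1\right)\ge1,$$ then $R'_{\mathrm{Asym}}(0)\ge0$. Otherwise $R'_{\mathrm{Asym}}(0)<0$.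
   Context: Strong and weak features model: linear regression $y_i=\langle\beta^\star,x_i\rangle+\sigma\epsilon_i$, $i=1,\dots,n$, with $x_i\sim\mathcal N(0,\Sigma)$ i.i.d. and noise of conditional mean $0$ and variance $1$. The covariance is $\Sigma=\rho_1U_1^\top U_1+\rho_2U_2^\top U_2$, where the rows of $U_1\in\mathbb{R}^{d_1\times d}$ and $U_2\in\mathbb{R}^{d_2\times d}$ together form an orthonormal basis of $\mathbb{R}^d$, $d_1+d_2=d$, and $\mathbf E[\beta^\star]=0$, $\mathbf E[\beta^\star(\beta^\star)^\top]=\frac{r^2}{d}(\phi_1U_1^\top U_1+\phi_2U_2^\top U_2)$. As $n,d\to\infty$, $d/n\to\gamma$ and $d_i/d\to\psi_i\in(0,1)$, $\psi_1+\psi_2=1$. The limiting spectral distribution of $\Sigma$ is $H=\psi_1\delta_{\rho_1}+\psi_2\delta_{\rho_2}$. The asymptotic (excess) risk of the ridge estimator $\widehat\beta_\lambda=(\frac{X^\top X}{n}+\lambda I)^{-1}\frac{X^\top Y}{n}$ in this model is $$R_{\mathrm{Asym}}(\lambda)=\frac{v'(-\lambda)}{v(-\lambda)^2}\Big(\sigma^2+r^2\sum_{i=1}^2\frac{\phi_i\psi_i\rho_i}{(\rho_iv(-\lambda)+1)^2}\Big)-\sigma^2,$$ where $v$ is the companion Stieltjes transform (Stieltjes transform of the limiting spectral distribution of $XX^\top/n$): for $\lambda\ge0$ (and $\gamma>1$), $v(-\lambda)$ is the positive solution of $$-\frac1{v(t)}=t-\gamma\Big(\frac{\psi_1\rho_1}{1+\rho_1v(t)}+\frac{\psi_2\rho_2}{1+\rho_2v(t)}\Big)\quad\text{at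 }t=-\lambda,$$ and $v'(t)=\partial v(t)/\partial t$. The values at $\lambda=0$ are understood as limits as $\lambda\to0^+$; $R'_{\mathrm{Asym}}(\lambda)$ is the derivative of $R_{\mathrm{Asym}}$ with respect to $\lambda$, and $R'_{\mathrm{Asym}}(0)$ is its (right) value at $\lambda=0$. *)

theory Defs
  imports "HOL-Analysis.Analysis"
begin

text \<open>
  \<open>gam\<close> is the limit of \<open>d / n\<close>; the limiting spectral distribution of the covariance is
  \<open>H = psi1 * delta(rho1) + psi2 * delta(rho2)\<close>.  The defining equation is the Silverstein
  equation \<open>- 1 / w = t - gam * (integral of s / (1 + s * w) dH(s))\<close> for this \<open>H\<close>.
\<close>

definition companion_eq ::
  "real \<Rightarrow> real \<Rightarrow> real \<Rightarrow> real \<Rightarrow> real \<Rightarrow> real \<Rightarrow> real \<Rightarrow> bool" where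
  "companion_eq gam psi1 psi2 rho1 rho2 t w \<longleftrightarrow>
     - 1 / w = t - gam * (psi1 * rho1 / (1 + rho1 * w) + psi2 * rho2 / (1 + rho2 * w))"

text \<open>
  Meaningful for \<open>t \<le> 0\<close> and \<open>gam > 1\<close> only, where the positive solution exists and is unique
  (\<open>companion_ex1\<close> below); for \<open>t > 0\<close> the value is unspecified.
\<close>

definition companion_v ::
  "real \<Rightarrow> real \<Rightarrow> real \<Rightarrow> real \<Rightarrow> real \<Rightarrow> real \<Rightarrow> real" where
  "companion_v gam psi1 psi2 rho1 rho2 t =
     (THE w. w > 0 \<and> companion_eq gam psi1 psi2 rho1 rho2 t w)"

text \<open>The risk formula for \<open>lam > 0\<close>; the derivative of \<open>v\<close> is with respect to its argument \<open>t\<close>.\<close>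

definition R_asym_pos ::
  "real \<Rightarrow> real \<Rightarrow> real \<Rightarrow> real \<Rightarrow> real \<Rightarrow> real \<Rightarrow> real \<Rightarrow> real \<Rightarrow> real \<Rightarrow> real \<Rightarrow> real" where
  "R_asym_pos gam psi1 psi2 rho1 rho2 phi1 phi2 r sig lam =
     (let v = companion_v gam psi1 psi2 rho1 rho2 in
      deriv v (- lam) / (v (- lam))\<^sup>2 *
        (sig\<^sup>2 + r\<^sup>2 * (phi1 * psi1 * rho1 / (rho1 * v (- lam) + 1)\<^sup>2 +
                     phi2 * psi2 * rho2 / (rho2 * v (- lam) + 1)\<^sup>2))
      - sig\<^sup>2)"

text \<open>
  The formula cannot be used verbatim at \<open>lam = 0\<close>, because \<open>v\<close> is only specified to the left of
  \<open>t = 0\<close> and so has no two-sided derivative there; the value at \<open>0\<close> is the limit from the right.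
\<close>

definition R_asym ::
  "real \<Rightarrow> real \<Rightarrow> real \<Rightarrow> real \<Rightarrow> real \<Rightarrow> real \<Rightarrow> real \<Rightarrow> real \<Rightarrow> real \<Rightarrow> real \<Rightarrow> real" where
  "R_asym gam psi1 psi2 rho1 rho2 phi1 phi2 r sig lam =
     (if lam = 0
      then Lim (at_right 0) (R_asym_pos gam psi1 psi2 rho1 rho2 phi1 phi2 r sig)
      else R_asym_pos gam psi1 psi2 rho1 rho2 phi1 phi2 r sig lam)"

lemma companion_ex1:
  fixes gam psi1 psi2 rho1 rho2 t :: real
  assumes "gam > 1" "psi1 > 0" "psi2 > 0" "psi1 + psi2 = 1" "rho1 > 0" "rho2 > 0" "t \<le> 0"
  shows "\<exists>!w. w > 0 \<and> companion_eq gam psi1 psi2 rho1 rho2 t w"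
proof -
  define F where "F = (\<lambda>w. gam * (psi1 * (1 - 1 / (1 + rho1 * w)) + psi2 * (1 - 1 / (1 + rho2 * w)))
      - t * w - 1)"
  have iff: "companion_eq gam psi1 psi2 rho1 rho2 t w \<longleftrightarrow> F w = 0" if "w > 0" for w
  proof -
    have p: "1 + rho1 * w > 0" "1 + rho2 * w > 0" using assms that by (simp_all add: add_pos_pos)
    have e: "F w = w * (gam * (psi1 * rho1 / (1 + rho1 * w) + psi2 * rho2 / (1 + rho2 * w)) - t - 1 / w)"
    proof -
      have q: "1 - 1 / (1 + rho1 * w) = w * (rho1 / (1 + rho1 * w))"
           "1 - 1 / (1 + rho2 * w) = w * (rho2 / (1 + rho2 * w))"
        using p by (simp_all add: field_simps)
      show ?thesis unfolding F_def q using that by (simp add: algebra_simps)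
    qed
    show ?thesis unfolding companion_eq_def e using that by auto
  qed
  have mono: "F a < F b" if "0 \<le> a" "a < b" for a b
  proof -
    have i: "1 / (1 + c * b) < 1 / (1 + c * a)" if "c > 0" for c
      using that \<open>0 \<le> a\<close> \<open>a < b\<close> by (intro divide_strict_left_mono) (auto intro!: mult_pos_pos add_pos_nonneg)
    have "psi1 * (1 - 1 / (1 + rho1 * a)) + psi2 * (1 - 1 / (1 + rho2 * a))
        < psi1 * (1 - 1 / (1 + rho1 * b)) + psi2 * (1 - 1 / (1 + rho2 * b))"
      using i[of rho1] i[of rho2] assms
      by (intro add_strict_mono mult_strict_left_mono) auto
    then have "gam * (psi1 * (1 - 1 / (1 + rho1 * a)) + psi2 * (1 - 1 / (1 + rho2 * a)))
        < gam * (psi1 * (1 - 1 / (1 + rho1 * b)) + psi2 * (1 - 1 / (1 + rho2 * b)))"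
      using assms by (intro mult_strict_left_mono) auto
    moreover have "t * b \<le> t * a" using assms that by (intro mult_left_mono_neg) auto
    ultimately show ?thesis unfolding F_def by linarith
  qed
  have F0: "F 0 = -1" by (simp add: F_def)
  define m where "m = min rho1 rho2"
  define b where "b = 1 / (m * (gam - 1))"
  have m: "m > 0" "m \<le> rho1" "m \<le> rho2" using assms by (auto simp: m_def)
  have b: "b > 0" using m assms by (simp add: b_def)
  have k: "1 / (1 + c * b) \<le> (gam - 1) / gam" if "m \<le> c" for c
  proof -
    have "0 < 1 + c * b" "0 < 1 + 1 / (gam - 1)"
      using that m b assms by (simp_all add: add_pos_pos)
    then have pp: "0 < (1 + c * b) * (1 + 1 / (gam - 1))" by simp
    have "1 + 1 / (gam - 1) = 1 + m * b" using m assms by (simp add: b_def)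
    also have "\<dots> \<le> 1 + c * b" using that b by simp
    finally have "1 / (1 + c * b) \<le> 1 / (1 + 1 / (gam - 1))"
      using pp by (intro divide_left_mono) (simp_all add: mult.commute)
    also have "\<dots> = (gam - 1) / gam" using assms by (simp add: field_simps)
    finally show ?thesis .
  qed
  have "(gam - 1) / gam = 1 - 1 / gam" using assms by (simp add: diff_divide_distrib)
  then have "1 / gam \<le> 1 - 1 / (1 + rho1 * b)" "1 / gam \<le> 1 - 1 / (1 + rho2 * b)"
    using k[of rho1] k[of rho2] m by linarith+
  then have "psi1 * (1 / gam) \<le> psi1 * (1 - 1 / (1 + rho1 * b))"
       "psi2 * (1 / gam) \<le> psi2 * (1 - 1 / (1 + rho2 * b))"
    using assms mult_left_mono[of "1 / gam" _ psi1] mult_left_mono[of "1 / gam" _ psi2]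
    by (meson less_imp_le)+
  then have "(psi1 + psi2) * (1 / gam)
      \<le> psi1 * (1 - 1 / (1 + rho1 * b)) + psi2 * (1 - 1 / (1 + rho2 * b))"
    unfolding distrib_right by linarith
  then have "1 \<le> gam * (psi1 * (1 - 1 / (1 + rho1 * b)) + psi2 * (1 - 1 / (1 + rho2 * b)))"
    using assms by (simp add: pos_divide_le_eq mult.commute)
  moreover have "t * b \<le> 0" using assms b by (simp add: mult_nonpos_nonneg)
  ultimately have Fb: "F b \<ge> 0" unfolding F_def by linarith
  have cont: "continuous_on {0..b} F"
  proof -
    have "1 + rho1 * x \<noteq> 0" "1 + rho2 * x \<noteq> 0" if "x \<in> {0..b}" for x
    proof -
      have "0 < 1 + rho1 * x" "0 < 1 + rho2 * x" using that assms by (auto intro!: add_pos_nonneg)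
      then show "1 + rho1 * x \<noteq> 0" "1 + rho2 * x \<noteq> 0" by auto
    qed
    then show ?thesis unfolding F_def by (intro continuous_intros) auto
  qed
  obtain w where w: "0 \<le> w" "w \<le> b" "F w = 0"
    using IVT'[of F 0 0 b] F0 Fb b cont by auto
  then have "w > 0" using F0 by (cases "w = 0") auto
  show ?thesis
  proof (rule ex1I[of _ w])
    show "w > 0 \<and> companion_eq gam psi1 psi2 rho1 rho2 t w" using iff w \<open>w > 0\<close> by auto
  next
    fix u assume u: "u > 0 \<and> companion_eq gam psi1 psi2 rho1 rho2 t u"
    then have "F u = 0" using iff by auto
    then show "u = w" using mono[of u w] mono[of w u] w u by (cases u w rule: linorder_cases) auto
  qed
qed

end

theory Submission
  imports Defs
begin

text \<open>
  Write \<open>sat c w = c w / (1 + c w)\<close>. For \<open>\<gamma> = 2\<close> and \<open>\<psi>\<^sub>1 = \<psi>\<^sub>2 = 1/2\<close> the companion equation is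
  \<open>sat \<rho>\<^sub>1 v + sat \<rho>\<^sub>2 v = 1 + t v\<close>. Subtracting this equation at two points \<open>s, t \<le> 0\<close>, with
  solutions \<open>x, y\<close>, gives the exact identity \<open>(s - t) x y = (x - y) gap x y\<close>, where
  \<open>gap x y = 1 - sat \<rho>\<^sub>1 x sat \<rho>\<^sub>1 y - sat \<rho>\<^sub>2 x sat \<rho>\<^sub>2 y\<close>. For nonpositive arguments the sums of
  saturations are at most \<open>1\<close>, so that \<open>gap x y\<close> is at least the sum of the cross products
  \<open>sat \<rho>\<^sub>1 x sat \<rho>\<^sub>2 y\<close> and \<open>sat \<rho>\<^sub>1 y sat \<rho>\<^sub>2 x\<close>, which is positive. Hence \<open>v\<close> is Lipschitz on
  \<open>(-\<infinity>, 0]\<close>, and the identity, read as a formula for the difference quotient, yields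
  \<open>v' = v\<^sup>2 / gap v v\<close> up to and including the end point \<open>0\<close> (lemma
  \<open>companion_has_derivative\<close>).

  The factor \<open>v' / v\<^sup>2\<close> in the risk is therefore \<open>1 / gap v v\<close>, and the risk is a rational function of
  \<open>v = v(-\<lambda>)\<close> alone, \<open>noise_signal v / gap v v - \<sigma>\<^sup>2\<close>, where \<open>noise_signal\<close> is the sum of \<open>\<sigma>\<^sup>2\<close> and
  the signal term. The chain rule differentiates it in \<open>\<lambda>\<close> on all of \<open>[0, \<infinity>)\<close>, and the
  derivative is again a continuous function of \<open>v\<close> (lemmas \<open>R_asym_has_derivative\<close> and
  \<open>risk_slope_tendsto\<close>).

  At \<open>t = 0\<close> the companion equation reduces to \<open>\<rho>\<^sub>1 \<rho>\<^sub>2 v\<^sup>2 = 1\<close>. With \<open>p = \<surd>\<rho>\<^sub>1\<close>, \<open>q = \<surd>\<rho>\<^sub>2\<close>,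
  the saturations at \<open>v(0) = 1 / (p q)\<close> are \<open>p / (p + q)\<close> and \<open>q / (p + q)\<close>, every term becomes
  explicit, and the derivative of the risk is a positive multiple of
  \<open>r\<^sup>2 (p q / (p + q))\<^sup>2 ((\<phi>\<^sub>1 p + \<phi>\<^sub>2 q) / (p + q) - 1) - \<sigma>\<^sup>2\<close>; dividing by \<open>\<sigma>\<^sup>2\<close> gives the
  stated criterion (lemma \<open>risk_slope_at_zero\<close>).
\<close>

section \<open>The companion equation in terms of saturations\<close>

definition sat :: "real \<Rightarrow> real \<Rightarrow> real" where
  "sat c w = c * w / (1 + c * w)"

text \<open>
  A divided difference: on the diagonal, \<open>gap a b w w / w\<^sup>2\<close> is the derivative of the argument \<open>t\<close>
  with respect to the solution \<open>w\<close>.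
\<close>

definition gap :: "real \<Rightarrow> real \<Rightarrow> real \<Rightarrow> real \<Rightarrow> real" where
  "gap a b x y = 1 - sat a x * sat a y - sat b x * sat b y"

abbreviation comp :: "real \<Rightarrow> real \<Rightarrow> real \<Rightarrow> real" where
  "comp a b \<equiv> companion_v 2 (1/2) (1/2) a b"

lemma sat_pos: "c > 0 \<Longrightarrow> w > 0 \<Longrightarrow> sat c w > 0"
  by (simp add: sat_def add_pos_pos)

lemma companion_eq_iff_sat:
  assumes "a > 0" "b > 0" "w > 0"
  shows "companion_eq 2 (1/2) (1/2) a b t w \<longleftrightarrow> sat a w + sat b w = 1 + t * w"
proof -
  let ?E = "- 1 / w - (t - 2 * (1/2 * a / (1 + a * w) + 1/2 * b / (1 + b * w)))"
  have "?E = - 1 / w - t + a / (1 + a * w) + b / (1 + b * w)"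
    by (simp only: distrib_left times_divide_eq_right times_divide_eq_left)
  then have "w * ?E = w * (- 1 / w) - w * t + w * (a / (1 + a * w)) + w * (b / (1 + b * w))"
    by (simp only: distrib_left right_diff_distrib)
  also have "\<dots> = - 1 - w * t + sat a w + sat b w"
    using assms by (simp add: sat_def mult.commute)
  finally have "w * ?E = - 1 - t * w + sat a w + sat b w" by (simp only: mult.commute[of w t])
  moreover have "?E = 0 \<longleftrightarrow> w * ?E = 0" using assms(3) by (metis mult_eq_0_iff less_irrefl)
  ultimately have "?E = 0 \<longleftrightarrow> sat a w + sat b w = 1 + t * w" by linarith
  then show ?thesis unfolding companion_eq_def by linarith
qed

lemma comp_pos_sat:
  assumes "a > 0" "b > 0" "t \<le> 0"
  shows "comp a b t > 0" and "sat a (comp a b t) + sat b (comp a b t) = 1 + t * comp a b t"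
proof -
  have "comp a b t > 0 \<and> companion_eq 2 (1/2) (1/2) a b t (comp a b t)"
    unfolding companion_v_def by (rule theI'[OF companion_ex1]) (simp_all add: assms)
  then show "comp a b t > 0" "sat a (comp a b t) + sat b (comp a b t) = 1 + t * comp a b t"
    using companion_eq_iff_sat[OF assms(1,2)] by blast+
qed

lemma sat_sum_deficit:
  assumes "a > 0" "b > 0" "w > 0"
  shows "sat a w + sat b w - 1 = (a * b * w\<^sup>2 - 1) / ((1 + a * w) * (1 + b * w))"
proof -
  have "1 + a * w \<noteq> 0" "1 + b * w \<noteq> 0" using assms by (smt (verit) mult_pos_pos)+
  then show ?thesis by (simp add: sat_def divide_simps) (simp add: algebra_simps power2_eq_square)
qed

lemma comp_zero:
  assumes "a > 0" "b > 0"
  shows "comp a b 0 = 1 / (sqrt a * sqrt b)"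
proof -
  let ?w = "comp a b 0"
  have w: "?w > 0" "sat a ?w + sat b ?w = 1" using comp_pos_sat[of a b 0] assms by auto
  have "1 + a * ?w > 0" "1 + b * ?w > 0" using w assms by (simp_all add: add_pos_pos)
  then have "a * b * ?w\<^sup>2 = 1" using sat_sum_deficit[OF assms w(1)] w(2) by simp
  then have "(sqrt a * sqrt b * ?w)\<^sup>2 = 1\<^sup>2" using assms by (simp add: power_mult_distrib)
  then have "sqrt a * sqrt b * ?w = 1"
    using w assms by (subst (asm) power2_eq_iff_nonneg) auto
  then show ?thesis using assms by (simp add: field_simps)
qed

lemma comp_le:
  assumes "a > 0" "b > 0" "t \<le> 0"
  shows "comp a b t \<le> 1 / sqrt (a * b)"
proof -
  let ?w = "comp a b t"
  note w = comp_pos_sat[OF assms]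
  have d: "1 + a * ?w > 0" "1 + b * ?w > 0" using w assms by (simp_all add: add_pos_pos)
  have "t * ?w \<le> 0" using w assms by (simp add: mult_nonpos_nonneg)
  then have "(a * b * ?w\<^sup>2 - 1) / ((1 + a * ?w) * (1 + b * ?w)) \<le> 0"
    using sat_sum_deficit[OF assms(1,2) w(1)] w(2) by linarith
  then have "a * b * ?w\<^sup>2 \<le> 1" using mult_pos_pos[OF d] by (auto simp: divide_le_0_iff)
  then have "sqrt (a * b * ?w\<^sup>2) \<le> 1" by simp
  then have "sqrt (a * b) * ?w \<le> 1" using w by (simp add: real_sqrt_mult)
  then show ?thesis using assms by (simp add: field_simps)
qed

section \<open>Regularity of the companion transform up to zero\<close>

lemma sat_divided_difference:
  assumes "c > 0" "x > 0" "y > 0"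
  shows "y * sat c x - x * sat c y = - (x - y) * (sat c x * sat c y)"
proof -
  have "1 + c * x \<noteq> 0" "1 + c * y \<noteq> 0" using assms by (smt (verit) mult_pos_pos)+
  then show ?thesis by (simp add: sat_def divide_simps) (simp add: algebra_simps)
qed

lemma comp_difference:
  assumes "a > 0" "b > 0" "s \<le> 0" "t \<le> 0"
  shows "(s - t) * (comp a b s * comp a b t)
       = (comp a b s - comp a b t) * gap a b (comp a b s) (comp a b t)"
proof -
  let ?x = "comp a b s" and ?y = "comp a b t"
  note x = comp_pos_sat[OF assms(1,2,3)] and y = comp_pos_sat[OF assms(1,2,4)]
  have "(s - t) * (?x * ?y) = ?y * (s * ?x) - ?x * (t * ?y)" by (simp add: algebra_simps)
  also have "\<dots> = ?y * (sat a ?x + sat b ?x - 1) - ?x * (sat a ?y + sat b ?y - 1)"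
    using x(2) y(2) by simp
  also have "\<dots> = (?y * sat a ?x - ?x * sat a ?y) + (?y * sat b ?x - ?x * sat b ?y) + (?x - ?y)"
    by (simp add: algebra_simps)
  also have "\<dots> = (?x - ?y) * gap a b ?x ?y"
    unfolding sat_divided_difference[OF assms(1) x(1) y(1)]
      sat_divided_difference[OF assms(2) x(1) y(1)]
    by (simp add: gap_def algebra_simps)
  finally show ?thesis .
qed

text \<open>
  Since the saturations sum to at most \<open>1\<close> at both points,
  \<open>1 \<ge> (sat a x + sat b x) (sat a y + sat b y)\<close>; after cancelling the products that occur in the gap,
  only the cross terms remain.
\<close>

lemma gap_ge_cross:
  assumes "a > 0" "b > 0" "s \<le> 0" "t \<le> 0"
  shows "gap a b (comp a b s) (comp a b t)
       \<ge> sat a (comp a b s) * sat b (comp a b t) + sat a (comp a b t) * sat b (comp a b s)"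
proof -
  let ?x = "comp a b s" and ?y = "comp a b t"
  note x = comp_pos_sat[OF assms(1,2,3)] and y = comp_pos_sat[OF assms(1,2,4)]
  have "s * ?x \<le> 0" "t * ?y \<le> 0" using x y assms by (simp_all add: mult_nonpos_nonneg)
  then have "sat a ?x + sat b ?x \<le> 1" "sat a ?y + sat b ?y \<le> 1" using x y by auto
  then have "(sat a ?x + sat b ?x) * (sat a ?y + sat b ?y) \<le> 1"
    using sat_pos[OF assms(1) y(1)] sat_pos[OF assms(2) y(1)] by (intro mult_le_one) linarith+
  then show ?thesis by (simp add: gap_def algebra_simps)
qed

lemma gap_comp_pos:
  assumes "a > 0" "b > 0" "s \<le> 0" "t \<le> 0"
  shows "gap a b (comp a b s) (comp a b t) > 0"
proof -
  note x = comp_pos_sat[OF assms(1,2,3)] and y = comp_pos_sat[OF assms(1,2,4)]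
  have "sat a (comp a b s) * sat b (comp a b t) + sat a (comp a b t) * sat b (comp a b s) > 0"
    using sat_pos assms x y by (intro add_pos_pos mult_pos_pos) auto
  then show ?thesis using gap_ge_cross[OF assms] by linarith
qed

text \<open>
  The identity bounds \<open>x - y\<close> by \<open>s - t\<close> times \<open>x y / gap a b x y\<close>. That quotient stays bounded even
  where the solutions tend to \<open>0\<close>: a saturation \<open>sat c w\<close> is at least \<open>w\<close> times a constant, as
  \<open>w\<close> never exceeds its value at \<open>t = 0\<close>.
\<close>

lemma comp_lipschitz:
  assumes "a > 0" "b > 0"
  obtains C where "C > 0"
    "\<And>s t. s \<le> 0 \<Longrightarrow> t \<le> 0 \<Longrightarrow> \<bar>comp a b s - comp a b t\<bar> \<le> C * \<bar>s - t\<bar>"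
proof -
  define M where "M = 1 / sqrt (a * b)"
  have M: "M > 0" using assms by (simp add: M_def)
  define ka kb where "ka = a / (1 + a * M)" and "kb = b / (1 + b * M)"
  have k: "ka > 0" "kb > 0" using assms M by (simp_all add: ka_def kb_def add_pos_pos)
  have lower: "c / (1 + c * M) * w \<le> sat c w" if "c > 0" "0 < w" "w \<le> M" for c w
  proof -
    have "1 + c * w \<le> 1 + c * M" "0 < 1 + c * w" using that by (auto intro: add_pos_pos)
    then have "c * w / (1 + c * M) \<le> c * w / (1 + c * w)"
      using mult_pos_pos[OF that(1,2)] by (intro divide_left_mono mult_pos_pos) linarith+
    then show ?thesis by (simp add: sat_def)
  qed
  show ?thesis
  proof (rule that[of "1 / (ka * kb)"])
    show "1 / (ka * kb) > 0" using k by simp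
    fix s t :: real assume st: "s \<le> 0" "t \<le> 0"
    let ?x = "comp a b s" and ?y = "comp a b t"
    have xy: "0 < ?x" "?x \<le> M" "0 < ?y" "?y \<le> M"
      unfolding M_def using comp_pos_sat(1)[OF assms] comp_le[OF assms] st by blast+
    have "(ka * kb) * (?x * ?y) = (ka * ?x) * (kb * ?y)" by simp
    also have "\<dots> \<le> sat a ?x * sat b ?y"
      using lower[OF assms(1) xy(1,2)] lower[OF assms(2) xy(3,4)] sat_pos[OF assms(1) xy(1)] k xy
      unfolding ka_def[symmetric] kb_def[symmetric] by (intro mult_mono) auto
    also have "\<dots> \<le> gap a b ?x ?y"
      using gap_ge_cross[OF assms st]
        mult_pos_pos[OF sat_pos[OF assms(1) xy(3)] sat_pos[OF assms(2) xy(1)]] by linarith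
    finally have "\<bar>?x - ?y\<bar> * ((ka * kb) * (?x * ?y)) \<le> \<bar>?x - ?y\<bar> * gap a b ?x ?y"
      by (intro mult_left_mono) auto
    also have "\<dots> = \<bar>s - t\<bar> * (?x * ?y)"
      using arg_cong[OF comp_difference[OF assms st], of abs] gap_comp_pos[OF assms st] xy
      by (simp add: abs_mult)
    finally have "(\<bar>?x - ?y\<bar> * (ka * kb)) * (?x * ?y) \<le> \<bar>s - t\<bar> * (?x * ?y)"
      by (simp add: mult.assoc)
    then have "\<bar>?x - ?y\<bar> * (ka * kb) \<le> \<bar>s - t\<bar>" using xy by simp
    then show "\<bar>?x - ?y\<bar> \<le> 1 / (ka * kb) * \<bar>s - t\<bar>"
      using k by (simp add: field_simps)
  qed
qed

lemma comp_continuous: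
  assumes "a > 0" "b > 0"
  shows "continuous_on {..0} (comp a b)"
proof -
  obtain C where C: "C > 0"
    "\<And>s t. s \<le> 0 \<Longrightarrow> t \<le> 0 \<Longrightarrow> \<bar>comp a b s - comp a b t\<bar> \<le> C * \<bar>s - t\<bar>"
    using comp_lipschitz[OF assms] by blast
  then have "C-lipschitz_on {..0} (comp a b)"
    by (intro lipschitz_onI) (auto simp: dist_real_def)
  then show ?thesis by (rule lipschitz_on_continuous_on)
qed

text \<open>
  Divided by \<open>(s - t) gap x y\<close>, the difference identity expresses the difference quotient of the
  solution as \<open>x y / gap x y\<close>, whose limit needs only continuity. This treats the end point \<open>t = 0\<close>
  like any other, where an inverse function theorem would require a neighbourhood.
\<close>

lemma companion_has_derivative:
  assumes "a > 0" "b > 0" "t \<le> 0"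
  shows "(comp a b has_real_derivative (comp a b t)\<^sup>2 / gap a b (comp a b t) (comp a b t))
           (at t within {..0})"
proof -
  let ?v = "comp a b"
  have lim: "(?v \<longlongrightarrow> ?v t) (at t within {..0})"
    using comp_continuous[OF assms(1,2)] assms(3) by (auto simp: continuous_on_def)
  have "1 + a * ?v t \<noteq> 0" "1 + b * ?v t \<noteq> 0"
    using comp_pos_sat(1)[OF assms] assms by (smt (verit) mult_pos_pos)+
  then have "((\<lambda>s. gap a b (?v s) (?v t)) \<longlongrightarrow> gap a b (?v t) (?v t)) (at t within {..0})"
    unfolding gap_def sat_def by (intro tendsto_intros lim)
  then have "((\<lambda>s. ?v s * ?v t / gap a b (?v s) (?v t)) \<longlongrightarrow>
      ?v t * ?v t / gap a b (?v t) (?v t)) (at t within {..0})"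
    using gap_comp_pos[OF assms(1,2,3,3)] by (intro tendsto_intros lim) auto
  moreover have "eventually (\<lambda>s. ?v s * ?v t / gap a b (?v s) (?v t)
      = (?v s - ?v t) / (s - t)) (at t within {..0})"
    unfolding eventually_at_filter
  proof (intro always_eventually allI impI)
    fix s assume "s \<noteq> t" "s \<in> {..0}"
    then show "?v s * ?v t / gap a b (?v s) (?v t) = (?v s - ?v t) / (s - t)"
      using comp_difference[of a b s t] gap_comp_pos[of a b s t] assms
      by (simp add: frac_eq_eq mult.commute)
  qed
  ultimately show ?thesis
    unfolding has_field_derivative_iff power2_eq_square by (rule Lim_transform_eventually)
qed

lemma deriv_companion:
  assumes "a > 0" "b > 0" "t < 0"
  shows "deriv (comp a b) t = (comp a b t)\<^sup>2 / gap a b (comp a b t) (comp a b t)"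
proof -
  have "at t within {..0} = at t"
    using assms by (intro at_within_interior) auto
  then show ?thesis
    using companion_has_derivative[of a b t] assms by (intro DERIV_imp_deriv) auto
qed

lemma comp_uminus_has_derivative:
  assumes "a > 0" "b > 0" "lam \<ge> 0"
  shows "((\<lambda>l. comp a b (- l)) has_real_derivative
      - ((comp a b (- lam))\<^sup>2 / gap a b (comp a b (- lam)) (comp a b (- lam)))) (at lam within {0..})"
proof -
  have im: "uminus ` {0..} = {..(0::real)}" by (simp add: image_uminus_atLeast)
  have "(comp a b \<circ> uminus has_real_derivative
      ((comp a b (- lam))\<^sup>2 / gap a b (comp a b (- lam)) (comp a b (- lam))) * (- 1))
      (at lam within {0..})"
    using companion_has_derivative[of a b "- lam"] assms
    by (intro DERIV_image_chain) (auto simp: im intro!: derivative_eq_intros)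
  then show ?thesis by (simp add: o_def)
qed

section \<open>The risk as a rational function of the companion transform\<close>

definition noise_signal ::
  "real \<Rightarrow> real \<Rightarrow> real \<Rightarrow> real \<Rightarrow> real \<Rightarrow> real \<Rightarrow> real \<Rightarrow> real" where
  "noise_signal a b phi1 phi2 r sig w =
     sig\<^sup>2 + r\<^sup>2 * (phi1 * (1/2) * a / (a * w + 1)\<^sup>2 + phi2 * (1/2) * b / (b * w + 1)\<^sup>2)"

definition noise_signal_deriv ::
  "real \<Rightarrow> real \<Rightarrow> real \<Rightarrow> real \<Rightarrow> real \<Rightarrow> real \<Rightarrow> real" where
  "noise_signal_deriv a b phi1 phi2 r w =
     - r\<^sup>2 * (phi1 * a\<^sup>2 / (1 + a * w)^3 + phi2 * b\<^sup>2 / (1 + b * w)^3)"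

definition gap_deriv :: "real \<Rightarrow> real \<Rightarrow> real \<Rightarrow> real" where
  "gap_deriv a b w = - 2 * (sat a w * a / (1 + a * w)\<^sup>2 + sat b w * b / (1 + b * w)\<^sup>2)"

text \<open>
  The quotient rule for \<open>noise_signal / gap\<close>, multiplied by \<open>- w\<^sup>2 / gap a b w w\<close>, the derivative of
  the solution \<open>w\<close> with respect to \<open>\<lambda> = - t\<close>.
\<close>

definition risk_slope ::
  "real \<Rightarrow> real \<Rightarrow> real \<Rightarrow> real \<Rightarrow> real \<Rightarrow> real \<Rightarrow> real \<Rightarrow> real" where
  "risk_slope a b phi1 phi2 r sig w =
     (noise_signal a b phi1 phi2 r sig w * gap_deriv a b w
       - noise_signal_deriv a b phi1 phi2 r w * gap a b w w) * w\<^sup>2 / (gap a b w w)^3"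

lemma DERIV_sat:
  assumes "1 + c * w \<noteq> 0"
  shows "(sat c has_real_derivative c / (1 + c * w)\<^sup>2) (at w)"
  unfolding sat_def[abs_def] using assms
  by (auto intro!: derivative_eq_intros simp: field_simps power2_eq_square)

lemma DERIV_gap_diag:
  assumes "1 + a * w \<noteq> 0" "1 + b * w \<noteq> 0"
  shows "((\<lambda>w. gap a b w w) has_real_derivative gap_deriv a b w) (at w)"
  unfolding gap_def gap_deriv_def
  by (rule derivative_eq_intros DERIV_sat assms refl)+ (simp add: algebra_simps)

lemma DERIV_inverse_square_term:
  assumes "1 + c * w \<noteq> (0::real)"
  shows "((\<lambda>w. k * (1/2) * c / (c * w + 1)\<^sup>2) has_real_derivative - (k * c\<^sup>2 / (1 + c * w)^3)) (at w)"
proof -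
  have "c * w + 1 \<noteq> 0" using assms by (simp add: add.commute)
  moreover have "((\<lambda>w. (c * w + 1)\<^sup>2) has_real_derivative 2 * (c * w + 1) * c) (at w)"
    by (auto intro!: derivative_eq_intros)
  ultimately have "((\<lambda>w. k * (1/2) * c / (c * w + 1)\<^sup>2) has_real_derivative
      - (k * (1/2) * c * (2 * (c * w + 1) * c)) / ((c * w + 1)\<^sup>2 * (c * w + 1)\<^sup>2)) (at w)"
    using DERIV_divide[OF DERIV_const, of "\<lambda>w. (c * w + 1)\<^sup>2" _ w UNIV "k * (1/2) * c"] by simp
  moreover have "- (k * (1/2) * c * (2 * z * c)) / (z\<^sup>2 * z\<^sup>2) = - (k * c\<^sup>2 / z^3)" if "z \<noteq> 0" for z
    using that by (simp add: power2_eq_square power3_eq_cube)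
  note this[OF \<open>c * w + 1 \<noteq> 0\<close>]
  ultimately show ?thesis by (simp only: add.commute[of "c * w"])
qed

lemma DERIV_noise_signal:
  assumes "1 + a * w \<noteq> 0" "1 + b * w \<noteq> 0"
  shows "(noise_signal a b phi1 phi2 r sig has_real_derivative
      noise_signal_deriv a b phi1 phi2 r w) (at w)"
proof -
  have "((\<lambda>w. sig\<^sup>2 + r\<^sup>2 * (phi1 * (1/2) * a / (a * w + 1)\<^sup>2 + phi2 * (1/2) * b / (b * w + 1)\<^sup>2))
      has_real_derivative
      0 + r\<^sup>2 * (- (phi1 * a\<^sup>2 / (1 + a * w)^3) + - (phi2 * b\<^sup>2 / (1 + b * w)^3))) (at w)"
    by (intro DERIV_add DERIV_const DERIV_cmult DERIV_inverse_square_term assms)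
  then show ?thesis unfolding noise_signal_def[abs_def] noise_signal_deriv_def
    by (simp add: algebra_simps)
qed

text \<open>
  For \<open>\<lambda> > 0\<close> this is the formula for the derivative of the companion transform; for \<open>\<lambda> = 0\<close>, where
  the risk is a limit, it is continuity of the right-hand side.
\<close>

lemma R_asym_eq:
  assumes "a > 0" "b > 0" "lam \<ge> 0"
  shows "R_asym 2 (1/2) (1/2) a b phi1 phi2 r sig lam =
     noise_signal a b phi1 phi2 r sig (comp a b (- lam))
       / gap a b (comp a b (- lam)) (comp a b (- lam)) - sig\<^sup>2"
proof -
  let ?u = "\<lambda>l. comp a b (- l)"
  let ?F = "\<lambda>l. noise_signal a b phi1 phi2 r sig (?u l) / gap a b (?u l) (?u l) - sig\<^sup>2"
  let ?R = "R_asym_pos 2 (1/2) (1/2) a b phi1 phi2 r sig"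
  have pos: "?R l = ?F l" if "l > 0" for l
    using that deriv_companion[OF assms(1,2), of "- l"] comp_pos_sat(1)[OF assms(1,2), of "- l"]
    by (simp add: R_asym_pos_def Let_def noise_signal_def)
  show ?thesis
  proof (cases "lam = 0")
    case False
    then show ?thesis using pos assms by (simp add: R_asym_def)
  next
    case True
    have u0: "comp a b 0 > 0" using comp_pos_sat(1)[OF assms(1,2), of 0] by simp
    then have nz: "1 + a * comp a b 0 \<noteq> 0" "1 + b * comp a b 0 \<noteq> 0"
      using assms by (smt (verit) mult_pos_pos)+
    have "(?u has_real_derivative - ((?u 0)\<^sup>2 / gap a b (?u 0) (?u 0))) (at 0 within {0..})"
      using comp_uminus_has_derivative[OF assms(1,2), of 0] by simp
    then have "(?u \<longlongrightarrow> ?u 0) (at 0 within {0..})"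
      using DERIV_continuous continuous_within by blast
    then have lim: "(?u \<longlongrightarrow> comp a b 0) (at_right 0)"
      by (auto intro: tendsto_within_subset)
    have "((\<lambda>l. noise_signal a b phi1 phi2 r sig (?u l)) \<longlongrightarrow>
        noise_signal a b phi1 phi2 r sig (comp a b 0)) (at_right 0)"
      by (rule isCont_tendsto_compose[OF DERIV_isCont[OF DERIV_noise_signal[OF nz]] lim])
    moreover have "((\<lambda>l. gap a b (?u l) (?u l)) \<longlongrightarrow> gap a b (comp a b 0) (comp a b 0)) (at_right 0)"
      by (rule isCont_tendsto_compose[OF DERIV_isCont[OF DERIV_gap_diag[OF nz]] lim])
    ultimately have "(?F \<longlongrightarrow> ?F 0) (at_right 0)"
      using gap_comp_pos[OF assms(1,2), of 0 0] by (intro tendsto_intros) auto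
    moreover have "eventually (\<lambda>l. ?F l = ?R l) (at_right 0)"
      using pos by (auto simp: eventually_at_filter)
    ultimately have "(?R \<longlongrightarrow> ?F 0) (at_right 0)" by (rule Lim_transform_eventually)
    then show ?thesis using True by (simp add: R_asym_def tendsto_Lim)
  qed
qed

lemma R_asym_has_derivative:
  assumes "a > 0" "b > 0" "lam \<ge> 0"
  shows "(R_asym 2 (1/2) (1/2) a b phi1 phi2 r sig has_real_derivative
      risk_slope a b phi1 phi2 r sig (comp a b (- lam))) (at lam within {0..})"
proof -
  let ?u = "\<lambda>l. comp a b (- l)"
  let ?N = "noise_signal a b phi1 phi2 r sig" and ?D = "\<lambda>w. gap a b w w"
  let ?w = "?u lam"
  have u0: "?w > 0" using comp_pos_sat(1) assms by simp
  then have nz: "1 + a * ?w \<noteq> 0" "1 + b * ?w \<noteq> 0"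
    using assms by (smt (verit) mult_pos_pos)+
  have D: "?D ?w \<noteq> 0" using gap_comp_pos[OF assms(1,2), of "- lam" "- lam"] assms by simp
  have G: "((\<lambda>w. ?N w / ?D w - sig\<^sup>2) has_real_derivative
      (noise_signal_deriv a b phi1 phi2 r ?w * ?D ?w - ?N ?w * gap_deriv a b ?w) / (?D ?w * ?D ?w))
      (at ?w)"
    using DERIV_diff[OF DERIV_divide[OF DERIV_noise_signal[OF nz] DERIV_gap_diag[OF nz] D]
        DERIV_const] by simp
  have "((\<lambda>l. ?N (?u l) / ?D (?u l) - sig\<^sup>2) has_real_derivative
      (noise_signal_deriv a b phi1 phi2 r ?w * ?D ?w - ?N ?w * gap_deriv a b ?w) / (?D ?w * ?D ?w)
        * (- (?w\<^sup>2 / ?D ?w))) (at lam within {0..})"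
    by (rule DERIV_chain2[OF G comp_uminus_has_derivative[OF assms]])
  moreover have "(noise_signal_deriv a b phi1 phi2 r ?w * ?D ?w - ?N ?w * gap_deriv a b ?w)
        / (?D ?w * ?D ?w) * (- (?w\<^sup>2 / ?D ?w)) = risk_slope a b phi1 phi2 r sig ?w"
    unfolding risk_slope_def using D by (simp add: field_simps power3_eq_cube)
  ultimately show ?thesis
    using R_asym_eq[OF assms(1,2)] assms(3)
    by (auto intro: has_field_derivative_transform_within[OF _ zero_less_one])
qed

section \<open>The slope at zero\<close>

lemma risk_slope_tendsto:
  assumes "a > 0" "b > 0"
  shows "((\<lambda>l. risk_slope a b phi1 phi2 r sig (comp a b (- l))) \<longlongrightarrow>
      risk_slope a b phi1 phi2 r sig (comp a b 0)) (at_right 0)"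
proof -
  have u0: "comp a b 0 > 0" using comp_pos_sat(1)[OF assms, of 0] by simp
  then have nz: "1 + a * comp a b 0 \<noteq> 0" "1 + b * comp a b 0 \<noteq> 0"
    using assms by (smt (verit) mult_pos_pos)+
  have D: "gap a b (comp a b 0) (comp a b 0) \<noteq> 0" using gap_comp_pos[OF assms, of 0 0] by simp
  have "continuous (at 0 within {0..}) (\<lambda>l. comp a b (- l))"
    using DERIV_continuous[OF comp_uminus_has_derivative[OF assms, of 0]] by simp
  then have lim: "((\<lambda>l. comp a b (- l)) \<longlongrightarrow> comp a b 0) (at_right 0)"
    by (auto simp: continuous_within intro: tendsto_within_subset)
  have "isCont (risk_slope a b phi1 phi2 r sig) (comp a b 0)"
    unfolding risk_slope_def[abs_def] noise_signal_deriv_def gap_deriv_def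
    using nz D
    by (intro continuous_intros DERIV_isCont[OF DERIV_noise_signal]
        DERIV_isCont[OF DERIV_gap_diag] DERIV_isCont[OF DERIV_sat]) auto
  then show ?thesis by (rule isCont_tendsto_compose[OF _ lim])
qed

text \<open>
  Only the sign of the slope matters, hence the unspecified positive factor. In the variables
  \<open>p = \<surd>a\<close> and \<open>q = \<surd>b\<close> everything is rational; the normalisation \<open>phi1 + phi2 = 2\<close> makes the
  signal term of \<open>noise_signal\<close> equal to \<open>r\<^sup>2 (p q / (p + q))\<^sup>2\<close>, which is the source of the \<open>- 1\<close>.
\<close>

lemma risk_slope_at_zero:
  assumes "a > 0" "b > 0" "phi1 + phi2 = 2"
  obtains K where "K > 0"
    "risk_slope a b phi1 phi2 r sig (comp a b 0) =
       K * (r\<^sup>2 * (a * b / (sqrt a + sqrt b)\<^sup>2)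
              * ((phi1 * sqrt a + phi2 * sqrt b) / (sqrt a + sqrt b) - 1) - sig\<^sup>2)"
proof -
  define p q where "p = sqrt a" and "q = sqrt b"
  have pq: "p > 0" "q > 0" "p + q > 0"
    using assms by (auto simp: p_def q_def intro!: add_pos_pos)
  have ab: "a = p\<^sup>2" "b = q\<^sup>2" using assms by (auto simp: p_def q_def)
  define w where "w = comp a b 0"
  have w: "w = 1 / (p * q)" unfolding w_def p_def q_def by (rule comp_zero[OF assms(1,2)])
  have d: "1 + a * w = (p + q) / q" "1 + b * w = (p + q) / p"
    "a * w + 1 = (p + q) / q" "b * w + 1 = (p + q) / p"
    using pq by (simp_all add: ab w field_simps power2_eq_square)
  have s: "sat a w = p / (p + q)" "sat b w = q / (p + q)"
    unfolding sat_def d using pq by (simp_all add: ab w field_simps power2_eq_square)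
  have gap: "gap a b w w = 2 * p * q / (p + q)\<^sup>2"
  proof -
    have "gap a b w w = ((p + q)\<^sup>2 - p\<^sup>2 - q\<^sup>2) / (p + q)\<^sup>2"
      unfolding gap_def s using pq by (simp add: diff_divide_distrib power2_eq_square)
    then show ?thesis by (simp add: power2_sum)
  qed
  have gap': "gap_deriv a b w = - 2 * (p\<^sup>2 * q\<^sup>2 / (p + q)\<^sup>2)"
  proof -
    have "sat a w * a / (1 + a * w)\<^sup>2 + sat b w * b / (1 + b * w)\<^sup>2
        = p^3 * q\<^sup>2 / (p + q)^3 + p\<^sup>2 * q^3 / (p + q)^3"
      unfolding s d unfolding ab by (simp add: power_divide power2_eq_square power3_eq_cube mult_ac)
    also have "\<dots> = p\<^sup>2 * q\<^sup>2 * (p + q) / (p + q)^3"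
      by (simp add: add_divide_distrib[symmetric] algebra_simps power2_eq_square power3_eq_cube)
    also have "\<dots> = p\<^sup>2 * q\<^sup>2 / (p + q)\<^sup>2"
      using pq by (simp add: power2_eq_square power3_eq_cube)
    finally show ?thesis by (simp add: gap_deriv_def)
  qed
  have N: "noise_signal a b phi1 phi2 r sig w = sig\<^sup>2 + r\<^sup>2 * (p\<^sup>2 * q\<^sup>2 / (p + q)\<^sup>2)"
  proof -
    have "phi1 * (1/2) * a / (a * w + 1)\<^sup>2 + phi2 * (1/2) * b / (b * w + 1)\<^sup>2
        = phi1 / 2 * (p\<^sup>2 * q\<^sup>2 / (p + q)\<^sup>2) + phi2 / 2 * (p\<^sup>2 * q\<^sup>2 / (p + q)\<^sup>2)"
      unfolding d unfolding ab by (simp add: power_divide mult_ac)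
    also have "\<dots> = (phi1 + phi2) / 2 * (p\<^sup>2 * q\<^sup>2 / (p + q)\<^sup>2)"
      by (simp only: distrib_right add_divide_distrib)
    finally have "phi1 * (1/2) * a / (a * w + 1)\<^sup>2 + phi2 * (1/2) * b / (b * w + 1)\<^sup>2
        = (phi1 + phi2) / 2 * (p\<^sup>2 * q\<^sup>2 / (p + q)\<^sup>2)" .
    then show ?thesis using assms(3) by (simp add: noise_signal_def)
  qed
  have N': "noise_signal_deriv a b phi1 phi2 r w
      = - r\<^sup>2 * (p^3 * q^3 / (p + q)^3 * (phi1 * p + phi2 * q))"
  proof -
    have "phi1 * a\<^sup>2 / (1 + a * w)^3 + phi2 * b\<^sup>2 / (1 + b * w)^3
        = phi1 * (p^4 * q^3 / (p + q)^3) + phi2 * (q^4 * p^3 / (p + q)^3)"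
      unfolding d unfolding ab by (simp add: power_divide flip: power_mult)
    also have "\<dots> = p^3 * q^3 / (p + q)^3 * (phi1 * p + phi2 * q)"
      by (simp add: distrib_left add_divide_distrib power4_eq_xxxx power3_eq_cube mult_ac)
    finally show ?thesis by (simp add: noise_signal_deriv_def)
  qed
  define X where "X = r\<^sup>2 * (p\<^sup>2 * q\<^sup>2 / (p + q)\<^sup>2) * ((phi1 * p + phi2 * q) / (p + q) - 1) - sig\<^sup>2"
  have "noise_signal a b phi1 phi2 r sig w * gap_deriv a b w
       - noise_signal_deriv a b phi1 phi2 r w * gap a b w w
     = 2 * (p\<^sup>2 * q\<^sup>2 / (p + q)\<^sup>2) * X"
  proof -
    have "p^3 * q^3 / (p + q)^3 * (phi1 * p + phi2 * q) * (2 * p * q / (p + q)\<^sup>2)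
        = 2 * (p\<^sup>2 * q\<^sup>2 / (p + q)\<^sup>2) * ((p\<^sup>2 * q\<^sup>2 / (p + q)\<^sup>2) * ((phi1 * p + phi2 * q) / (p + q)))"
      by (simp add: power2_eq_square power3_eq_cube mult_ac)
    moreover have "(S + R * A) * (- 2 * A) - (- R * E) * g = 2 * A * (R * A * (F - 1) - S)"
      if "E * g = 2 * A * (A * F)" for S R A E g F :: real
    proof -
      have "(S + R * A) * (- 2 * A) - (- R * E) * g = (S + R * A) * (- 2 * A) + R * (E * g)"
        by simp
      also have "\<dots> = 2 * A * (R * A * (F - 1) - S)" unfolding that by (simp add: algebra_simps)
      finally show ?thesis .
    qed
    ultimately show ?thesis unfolding N N' gap gap' X_def by blast
  qed
  then have slope: "risk_slope a b phi1 phi2 r sig w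
      = (2 * (p\<^sup>2 * q\<^sup>2 / (p + q)\<^sup>2) * w\<^sup>2 / (gap a b w w)^3) * X"
    by (simp add: risk_slope_def)
  show ?thesis
  proof (rule that)
    show "2 * (p\<^sup>2 * q\<^sup>2 / (p + q)\<^sup>2) * w\<^sup>2 / (gap a b w w)^3 > 0"
    proof -
      have "w > 0" "gap a b w w > 0" unfolding gap unfolding w using pq by simp_all
      then show ?thesis using pq by simp
    qed
    show "risk_slope a b phi1 phi2 r sig (comp a b 0) =
       (2 * (p\<^sup>2 * q\<^sup>2 / (p + q)\<^sup>2) * w\<^sup>2 / (gap a b w w)^3)
         * (r\<^sup>2 * (a * b / (sqrt a + sqrt b)\<^sup>2)
              * ((phi1 * sqrt a + phi2 * sqrt b) / (sqrt a + sqrt b) - 1) - sig\<^sup>2)"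
      using slope unfolding w_def[symmetric] X_def p_def[symmetric] q_def[symmetric]
      by (simp add: ab)
  qed
qed

theorem corollary2:
  fixes gam psi1 psi2 rho1 rho2 phi1 phi2 r sig :: real
  assumes "rho1 \<ge> rho2" and "rho2 > 0"
    and "sig\<^sup>2 > 0" and "r > 0"
    and "phi1 \<ge> 0" and "phi2 \<ge> 0"
    and "gam = 2" and "psi1 = 1/2" and "psi2 = 1/2"
    and "phi1 * psi1 + phi2 * psi2 = 1"
  shows "\<exists>R'. (\<forall>lam\<ge>0. (R_asym gam psi1 psi2 rho1 rho2 phi1 phi2 r sig
                  has_real_derivative R' lam) (at lam within {0..})) \<and>
              (R' \<longlongrightarrow> R' 0) (at_right 0) \<and>
              (if r\<^sup>2 / sig\<^sup>2 * (rho1 * rho2 / (sqrt rho1 + sqrt rho2)\<^sup>2) *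
                    ((phi1 * sqrt rho1 + phi2 * sqrt rho2) / (sqrt rho1 + sqrt rho2) - 1) \<ge> 1
               then R' 0 \<ge> 0 else R' 0 < 0)"
proof -
  have pos: "rho1 > 0" "rho2 > 0" using assms by auto
  have "phi1 + phi2 = 2" using assms(10) unfolding assms(8,9) by simp
  define R' where "R' = (\<lambda>lam. risk_slope rho1 rho2 phi1 phi2 r sig (comp rho1 rho2 (- lam)))"
  let ?Y = "(rho1 * rho2 / (sqrt rho1 + sqrt rho2)\<^sup>2) *
      ((phi1 * sqrt rho1 + phi2 * sqrt rho2) / (sqrt rho1 + sqrt rho2) - 1)"
  obtain K where K: "K > 0" "R' 0 = K * (r\<^sup>2 * ?Y - sig\<^sup>2)"
    using risk_slope_at_zero[OF pos \<open>phi1 + phi2 = 2\<close>, of r sig]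
    unfolding R'_def by (auto simp: mult.assoc)
  have crit: "r\<^sup>2 / sig\<^sup>2 * ?Y \<ge> 1 \<longleftrightarrow> r\<^sup>2 * ?Y - sig\<^sup>2 \<ge> 0"
    using assms(3) by (simp add: le_divide_eq)
  have "if r\<^sup>2 / sig\<^sup>2 * ?Y \<ge> 1 then R' 0 \<ge> 0 else R' 0 < 0"
    using K crit by (auto simp: mult_less_0_iff zero_le_mult_iff not_le)
  moreover have "\<forall>lam\<ge>0. (R_asym gam psi1 psi2 rho1 rho2 phi1 phi2 r sig
      has_real_derivative R' lam) (at lam within {0..})"
    using R_asym_has_derivative[OF pos] unfolding R'_def assms(7,8,9) by blast
  moreover have "(R' \<longlongrightarrow> R' 0) (at_right 0)"
    using risk_slope_tendsto[OF pos] unfolding R'_def by simp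
  ultimately show ?thesis by (intro exI[of _ R'] conjI) (auto simp: mult.assoc)
qed

end
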